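(* Let $P$ be the level poset of an $n\times n$ binary matrix $M$. Then the $n\times n$ matrix $\Psi=(\Psi_{x,y})$ of the $\mathbf{a}\mathbf{b}$-series of $P$ is the unique $n\times n$ matrix with entries in $\mathbb{R}\langle\langle\mathbf{a},\mathbf{b}\rangle\rangle$ satisfying the system of equations $$\left.\Psi\right|_{\mathbf{a}=t,\ \mathbf{b}=0}=K(t),\qquad \Delta(\Psi)=\Psi\cdot\mathbf{t}\cdot\Psi ,$$ where $K(t)=M+\operatorname{Bin}(M^2)\,t+\operatorname{Bin}(M^3)\,t^2+\cdots$ and the derivation $\Delta$ is applied entrywise.
   Context: For a nonnegative square matrix $A$, $\operatorname{Bin}(A)$ is the $0/1$ matrix obtained by replacing each nonzero entry of $A$ by $1$. Level poset: let $M$ be a $0/1$ square matrix with rows and columns indexed by a finite nonempty set $V$. The level poset of $M$ is the poset on $V\times\mathbb{Z}$ with $(u,i)<(v,j)$ if and only if $i<j$ and $(M^{j-i})_{u,v}>0$; the second coordinate is its rank function. $\mathbf{a}\mathbf{b}$-index: for a finite graded poset $Q$ of rank $m+1$ with minimum $\hat0$, maximum $\hat1$ and rank function $\rho$, and a chain $c=\{\hat0=x_0<x_1<\cdots<x_{k+1}=\hat1\}$, put $$\operatorname{wt}(c)=(\mathbf{a}-\mathbf{b})^{\rho(x_0,x_1)-1}\cdot\mathbf{b}\cdot(\mathbf{a}-\mathbf{b})^{\rho(x_1,x_2)-1}\cdot\mathbf{b}\cdots\mathbf{b}\cdot(\mathbf{a}-\mathbf{b})^{\rho(x_k,x_{k+1})-1},$$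 where $\rho(x,y)=\rho(y)-\rho(x)$ and $\mathbf{a},\mathbf{b}$ are non-commuting variables of degree one. Then $\Psi(Q)=\sum_c\operatorname{wt}(c)$, summed over all chains $c$ containing $\hat0$ and $\hat1$; it is homogeneous of degree $m$. $\mathbf{a}\mathbf{b}$-series: $\Psi_{x,y}=\sum_{m\ge0}\Psi([(x,0),(y,m+1)])\in\mathbb{R}\langle\langle\mathbf{a},\mathbf{b}\rangle\rangle$, where $\Psi([(x,0),(y,m+1)])$ is taken to be $0$ if $(x,0)\not\le(y,m+1)$. Derivation: $\Delta:\mathbb{R}\langle\langle\mathbf{a},\mathbf{b}\rangle\rangle\to\mathbb{R}\langle\langle\mathbf{a},\mathbf{b},\mathbf{t}\rangle\rangle$ is the (degree-by-degree extended) linear map with $\Delta(1)=0$, $\Delta(\mathbf{a})=\Delta(\mathbf{b})=\mathbf{t}$ and $\Delta(u\cdot v)=\Delta(u)\cdot v+u\cdot\Delta(v)$, where $\mathbf{t}$ is a third non-commuting variable. The variable $t$ in $K(t)$ is an ordinary formal variable, unrelated to $\mathbf{t}$. *)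

theory Defs
  imports "HOL-Analysis.Analysis" "HOL-Computational_Algebra.Formal_Power_Series"
begin

section \<open>Noncommutative formal power series over the reals\<close>

text \<open>A series in non-commuting variables indexed by \<^typ>\<open>'l\<close> is its family of coefficients,
  indexed by words over \<^typ>\<open>'l\<close>; the product is the Cauchy product.\<close>

typedef 'l ncseries = "UNIV :: ('l list \<Rightarrow> real) set"
  morphisms coeff_nc Abs_nc by simp

setup_lifting type_definition_ncseries

lemma nc_eqI: "(\<And>w. coeff_nc f w = coeff_nc g w) \<Longrightarrow> f = g"
  by transfer auto

lemma mult_assoc_splits:
  fixes F :: "nat \<Rightarrow> nat \<Rightarrow> real"
  shows "(\<Sum>i\<le>n. \<Sum>j\<le>i. F j i) = (\<Sum>j\<le>n. \<Sum>k\<le>n - j. F j (j + k))"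
proof -
  have "(\<Sum>i\<le>n. \<Sum>j\<le>i. F j i) = (\<Sum>(i, j)\<in>(SIGMA i:{..n}. {..i}). F j i)"
    by (simp add: sum.Sigma)
  also have "\<dots> = (\<Sum>(j, k)\<in>(SIGMA j:{..n}. {..n - j}). F j (j + k))"
    by (rule sum.reindex_bij_witness[where i = "\<lambda>(j, k). (j + k, j)" and j = "\<lambda>(i, j). (j, i - j)"])
       auto
  finally show ?thesis by (simp add: sum.Sigma)
qed

instantiation ncseries :: (type) ring_1
begin

lift_definition zero_ncseries :: "'a ncseries" is "\<lambda>w. 0" .
lift_definition one_ncseries :: "'a ncseries" is "\<lambda>w. if w = [] then 1 else 0" .
lift_definition plus_ncseries :: "'a ncseries \<Rightarrow> 'a ncseries \<Rightarrow> 'a ncseries"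
  is "\<lambda>f g w. f w + g w" .
lift_definition minus_ncseries :: "'a ncseries \<Rightarrow> 'a ncseries \<Rightarrow> 'a ncseries"
  is "\<lambda>f g w. f w - g w" .
lift_definition uminus_ncseries :: "'a ncseries \<Rightarrow> 'a ncseries"
  is "\<lambda>f w. - f w" .
lift_definition times_ncseries :: "'a ncseries \<Rightarrow> 'a ncseries \<Rightarrow> 'a ncseries"
  is "\<lambda>f g w. \<Sum>i\<le>length w. f (take i w) * g (drop i w)" .

instance
proof
  fix a b c :: "'a ncseries"
  show "a * b * c = a * (b * c)"
  proof (transfer, rule ext)
    fix a b c :: "'a list \<Rightarrow> real" and w :: "'a list"
    let ?F = "\<lambda>j i. a (take j w) * b (drop j (take i w)) * c (drop i w)"
    have "(\<Sum>i\<le>length w. (\<Sum>j\<le>length (take i w). a (take j (take i w)) * b (drop j (take i w))) * c (drop i w))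
        = (\<Sum>i\<le>length w. \<Sum>j\<le>i. ?F j i)"
      by (intro sum.cong refl) (auto simp: sum_distrib_right min_def intro!: sum.cong)
    also have "\<dots> = (\<Sum>j\<le>length w. \<Sum>k\<le>length w - j. ?F j (j + k))"
      by (rule mult_assoc_splits)
    also have "\<dots> = (\<Sum>j\<le>length w. a (take j w) *
        (\<Sum>k\<le>length (drop j w). b (take k (drop j w)) * c (drop k (drop j w))))"
      by (intro sum.cong refl) (auto simp: sum_distrib_left take_drop add.commute mult.assoc intro!: sum.cong)
    finally show "(\<Sum>i\<le>length w. (\<Sum>j\<le>length (take i w). a (take j (take i w)) * b (drop j (take i w))) * c (drop i w))
        = (\<Sum>j\<le>length w. a (take j w) *
        (\<Sum>k\<le>length (drop j w). b (take k (drop j w)) * c (drop k (drop j w))))" .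
  qed
  show "1 * a = a"
  proof (transfer, rule ext)
    fix a :: "'a list \<Rightarrow> real" and w :: "'a list"
    have "(\<Sum>i\<le>length w. (if take i w = [] then 1 else 0) * a (drop i w))
        = (\<Sum>i\<in>{0}. a (drop i w))"
      by (rule sum.mono_neutral_cong_right) auto
    then show "(\<Sum>i\<le>length w. (if take i w = [] then 1 else 0) * a (drop i w)) = a w" by simp
  qed
  show "a * 1 = a"
  proof (transfer, rule ext)
    fix a :: "'a list \<Rightarrow> real" and w :: "'a list"
    have "(\<Sum>i\<le>length w. a (take i w) * (if drop i w = [] then 1 else 0))
        = (\<Sum>i\<in>{length w}. a (take i w))"
      by (rule sum.mono_neutral_cong_right) auto
    then show "(\<Sum>i\<le>length w. a (take i w) * (if drop i w = [] then 1 else 0)) = a w" by simp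
  qed
  show "(a + b) * c = a * c + b * c"
    by transfer (auto simp: algebra_simps sum.distrib)
  show "a * (b + c) = a * b + a * c"
    by transfer (auto simp: algebra_simps sum.distrib)
  show "(0 :: 'a ncseries) \<noteq> 1" by transfer (auto simp: fun_eq_iff)
qed (transfer; auto simp: fun_eq_iff)+

end

lift_definition word :: "'l list \<Rightarrow> 'l ncseries" is "\<lambda>u w. if w = u then 1 else 0" .

abbreviation var :: "'l \<Rightarrow> 'l ncseries" where "var x \<equiv> word [x]"

lemma word_Nil: "word [] = 1"
  by transfer auto

text \<open>If \<open>\<phi>\<close> sends each word of length \<open>k\<close> to a homogeneous series of degree \<open>k\<close>, then
  \<open>extend \<phi>\<close> is its degree-by-degree linear extension to all series: the part of degree \<open>k\<close> of
  the result is the finite sum of \<open>f\<^sub>w \<phi>(w)\<close> over the words \<open>w\<close> of length \<open>k\<close>.\<close>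

definition extend :: "('l::finite list \<Rightarrow> 'm ncseries) \<Rightarrow> 'l ncseries \<Rightarrow> 'm ncseries" where
  "extend \<phi> f = Abs_nc (\<lambda>v. \<Sum>w | length w = length v. coeff_nc f w * coeff_nc (\<phi> w) v)"


section \<open>The variables a, b, t and the derivation\<close>

datatype ab = Va | Vb

lemma UNIV_ab: "(UNIV :: ab set) = {Va, Vb}"
  using ab.exhaust by auto

instance ab :: finite
  by standard (simp add: UNIV_ab)

datatype abt = AB ab | Vt

definition incl :: "ab ncseries \<Rightarrow> abt ncseries" where
  "incl = extend (\<lambda>w. word (map AB w))"

text \<open>The Leibniz rule, peeling off the first letter.\<close>

primrec Delta_word :: "ab list \<Rightarrow> abt ncseries" where
  "Delta_word [] = 0"
| "Delta_word (x # w) = var Vt * word (map AB w) + var (AB x) * Delta_word w"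

definition Delta :: "ab ncseries \<Rightarrow> abt ncseries" where
  "Delta = extend Delta_word"

text \<open>The substitution \<open>a = t, b = 0\<close>. A word of length \<open>k\<close> goes to a multiple of \<open>t\<^sup>k\<close>, so only
  words of length \<open>k\<close> contribute to the coefficient of \<open>t\<^sup>k\<close>.\<close>

primrec subst_letter :: "ab \<Rightarrow> real fps" where
  "subst_letter Va = fps_X"
| "subst_letter Vb = 0"

definition subst_a_t_b_0 :: "ab ncseries \<Rightarrow> real fps" where
  "subst_a_t_b_0 f =
     Abs_fps (\<lambda>k. \<Sum>w | length w = k. coeff_nc f w * fps_nth (prod_list (map subst_letter w)) k)"

lemma finite_words: "finite {w :: 'l::finite list. length w = k}"
  using finite_lists_length_eq[of "UNIV :: 'l set" k] by simp

lemma coeff_extend: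
  "coeff_nc (extend \<phi> f) v = (\<Sum>w | length w = length v. coeff_nc f w * coeff_nc (\<phi> w) v)"
  by (simp add: extend_def Abs_nc_inverse)

lemma extend_word:
  assumes "\<And>v. length v \<noteq> length u \<Longrightarrow> coeff_nc (\<phi> u) v = 0"
  shows "extend \<phi> (word u) = \<phi> u"
proof (rule nc_eqI)
  fix v
  have "coeff_nc (extend \<phi> (word u)) v
      = (\<Sum>w | length w = length v. if w = u then coeff_nc (\<phi> w) v else 0)"
    by (auto simp: coeff_extend word.rep_eq intro!: sum.cong)
  also have "\<dots> = coeff_nc (\<phi> u) v"
    using assms[of v] by (simp add: sum.delta finite_words) 
  finally show "coeff_nc (extend \<phi> (word u)) v = coeff_nc (\<phi> u) v" .
qed

lemma coeff_mult:
  "coeff_nc (f * g) w = (\<Sum>i\<le>length w. coeff_nc f (take i w) * coeff_nc g (drop i w))"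
  by transfer simp

lemma word_append: "word u * word v = word (u @ v)"
proof (rule nc_eqI)
  fix w
  have *: "take i w = u \<and> drop i w = v \<longleftrightarrow> i = length u \<and> w = u @ v"
    if "i \<le> length w" for i
  proof
    assume "take i w = u \<and> drop i w = v"
    then show "i = length u \<and> w = u @ v"
      using that append_take_drop_id[of i w] by (metis length_take min.absorb2)
  qed simp
  have "coeff_nc (word u * word v) w
      = (\<Sum>i\<le>length w. if take i w = u \<and> drop i w = v then 1 else 0)"
    unfolding coeff_mult word.rep_eq by (intro sum.cong refl) simp
  also have "\<dots> = (\<Sum>i\<le>length w. if i = length u then (if w = u @ v then 1 else 0) else 0)"
    by (intro sum.cong refl) (simp add: *)
  also have "\<dots> = coeff_nc (word (u @ v)) w"
    by (auto simp: word.rep_eq)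
  finally show "coeff_nc (word u * word v) w = coeff_nc (word (u @ v)) w" .
qed

lemma Delta_word_append:
  "Delta_word (u @ v) = Delta_word u * word (map AB v) + word (map AB u) * Delta_word v"
proof (induction u)
  case (Cons x u)
  have 1: "word (map AB u @ map AB v) = word (map AB u) * word (map AB v)"
    by (simp only: word_append)
  have 2: "word (AB x # map AB u) = var (AB x) * word (map AB u)"
    by (simp add: word_append)
  show ?case
    by (simp only: append_Cons Delta_word.simps map_append list.map Cons.IH 1 2
        distrib_left distrib_right mult.assoc add.assoc)
qed (simp add: word_Nil)

lemma Delta_word_homogeneous: "length v \<noteq> length u \<Longrightarrow> coeff_nc (Delta_word u) v = 0"
proof (induction u arbitrary: v)
  case Nil
  then show ?case by (simp add: zero_ncseries.rep_eq)
next
  case (Cons x u)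
  have "coeff_nc (var (AB x) * Delta_word u) v = 0"
    unfolding coeff_mult
    using Cons by (intro sum.neutral) (auto simp: word.rep_eq dest: arg_cong[of _ _ length])
  moreover have "coeff_nc (word (Vt # map AB u)) v = 0"
    using Cons.prems by (auto simp: word.rep_eq)
  ultimately show ?case by (simp add: plus_ncseries.rep_eq word_append)
qed

lemma Delta_one: "Delta 1 = 0"
  using extend_word[of "[]" Delta_word] Delta_word_homogeneous[of _ "[]"]
  by (simp add: Delta_def word_Nil)

lemma Delta_var: "Delta (var x) = var Vt"
  using extend_word[of "[x]" Delta_word] Delta_word_homogeneous[of _ "[x]"]
  by (simp add: Delta_def word_Nil)

lemma Delta_add: "Delta (f + g) = Delta f + Delta g"
  by (rule nc_eqI) (simp add: Delta_def coeff_extend plus_ncseries.rep_eq algebra_simps sum.distrib)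

lemma sum_words_split:
  fixes F :: "'l::finite list \<Rightarrow> 'l list \<Rightarrow> real"
  assumes "i \<le> n"
  shows "(\<Sum>w | length w = n. F (take i w) (drop i w))
       = (\<Sum>p | length p = i. \<Sum>q | length q = n - i. F p q)"
proof -
  have "(\<Sum>w | length w = n. F (take i w) (drop i w))
      = (\<Sum>(p, q)\<in>{p. length p = i} \<times> {q. length q = n - i}. F p q)"
    by (rule sum.reindex_bij_witness[where i = "\<lambda>(p, q). p @ q" and j = "\<lambda>w. (take i w, drop i w)"])
       (use assms in auto)
  then show ?thesis by (simp add: sum.cartesian_product)
qed

lemma coeff_mult_homogeneous:
  assumes f: "\<And>v. length v \<noteq> k \<Longrightarrow> coeff_nc f v = 0" and "k \<le> length v"
  shows "coeff_nc (f * g) v = coeff_nc f (take k v) * coeff_nc g (drop k v)"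
proof -
  have "coeff_nc (f * g) v = (\<Sum>i\<in>{k}. coeff_nc f (take i v) * coeff_nc g (drop i v))"
    unfolding coeff_mult
    by (rule sum.mono_neutral_cong_right) (use assms in \<open>auto simp: min_def\<close>)
  then show ?thesis by simp
qed

lemma Delta_mult: "Delta (f * g) = Delta f * incl g + incl f * Delta g"
proof (rule nc_eqI)
  fix v :: "abt list"
  define n where "n = length v"
  define e :: "ab list \<Rightarrow> abt ncseries" where "e w = word (map AB w)" for w
  have eh: "coeff_nc (e u) v = 0" if "length v \<noteq> length u" for u v
    using that by (auto simp: e_def word.rep_eq)
  have "coeff_nc (Delta (f * g)) v = (\<Sum>w | length w = n.
      \<Sum>i\<le>n. coeff_nc f (take i w) * coeff_nc g (drop i w) * coeff_nc (Delta_word (take i w @ drop i w)) v)"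
    by (auto simp: Delta_def coeff_extend coeff_mult sum_distrib_right n_def intro!: sum.cong)
  also have "\<dots> = (\<Sum>i\<le>n. \<Sum>w | length w = n.
      coeff_nc f (take i w) * coeff_nc g (drop i w) * coeff_nc (Delta_word (take i w @ drop i w)) v)"
    by (rule sum.swap)
  also have "\<dots> = (\<Sum>i\<le>n. \<Sum>p | length p = i. \<Sum>q | length q = n - i.
      coeff_nc f p * coeff_nc g q * coeff_nc (Delta_word (p @ q)) v)"
    by (rule sum.cong[OF refl], rule sum_words_split) simp
  also have "\<dots> = (\<Sum>i\<le>n. \<Sum>p | length p = i. \<Sum>q | length q = n - i.
      (coeff_nc f p * coeff_nc (Delta_word p) (take i v)) * (coeff_nc g q * coeff_nc (e q) (drop i v))
    + (coeff_nc f p * coeff_nc (e p) (take i v)) * (coeff_nc g q * coeff_nc (Delta_word q) (drop i v)))"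
  proof (intro sum.cong refl)
    fix i p q assume "i \<in> {..n}" "p \<in> {p :: ab list. length p = i}"
    then have "length p \<le> length v" "i = length p" by (auto simp: n_def)
    then show "coeff_nc f p * coeff_nc g q * coeff_nc (Delta_word (p @ q)) v =
      (coeff_nc f p * coeff_nc (Delta_word p) (take i v)) * (coeff_nc g q * coeff_nc (e q) (drop i v))
    + (coeff_nc f p * coeff_nc (e p) (take i v)) * (coeff_nc g q * coeff_nc (Delta_word q) (drop i v))"
      using coeff_mult_homogeneous[of "length p" "Delta_word p" v "e q"] Delta_word_homogeneous[of _ p]
        coeff_mult_homogeneous[of "length p" "e p" v "Delta_word q"] eh[of _ p]
      by (simp add: Delta_word_append plus_ncseries.rep_eq algebra_simps flip: e_def)
  qed
  also have "\<dots> = (\<Sum>i\<le>n. coeff_nc (Delta f) (take i v) * coeff_nc (incl g) (drop i v)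
    + coeff_nc (incl f) (take i v) * coeff_nc (Delta g) (drop i v))"
    by (intro sum.cong refl)
       (auto simp: Delta_def incl_def coeff_extend n_def e_def min_def sum.distrib sum_product)
  also have "\<dots> = coeff_nc (Delta f * incl g + incl f * Delta g) v"
    by (simp add: plus_ncseries.rep_eq coeff_mult sum.distrib n_def)
  finally show "coeff_nc (Delta (f * g)) v = coeff_nc (Delta f * incl g + incl f * Delta g) v" .
qed


section \<open>The ab-index of a finite graded poset\<close>

text \<open>A finite graded poset is given by its carrier \<open>Q\<close>, strict order \<open>lt\<close>, rank function \<open>rk\<close>
  (which matters only up to an additive constant), minimum \<open>x\<close> and maximum \<open>y\<close>, with \<open>x \<noteq> y\<close>.
  A chain is written as the list of its elements in increasing order.\<close>

definition bounded_chains :: "'p set \<Rightarrow> ('p \<Rightarrow> 'p \<Rightarrow> bool) \<Rightarrow> 'p \<Rightarrow> 'p \<Rightarrow> 'p list set" where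
  "bounded_chains Q lt x y =
     {c. set c \<subseteq> Q \<and> sorted_wrt lt c \<and> 2 \<le> length c \<and> hd c = x \<and> last c = y}"

fun wt :: "('p \<Rightarrow> int) \<Rightarrow> 'p list \<Rightarrow> ab ncseries" where
  "wt rk (x # y # z # c) = (var Va - var Vb) ^ nat (rk y - rk x - 1) * var Vb * wt rk (y # z # c)"
| "wt rk [x, y] = (var Va - var Vb) ^ nat (rk y - rk x - 1)"
| "wt rk _ = 1"

definition ab_index ::
  "'p set \<Rightarrow> ('p \<Rightarrow> 'p \<Rightarrow> bool) \<Rightarrow> ('p \<Rightarrow> int) \<Rightarrow> 'p \<Rightarrow> 'p \<Rightarrow> ab ncseries" where
  "ab_index Q lt rk x y = (\<Sum>c\<in>bounded_chains Q lt x y. wt rk c)"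


section \<open>Level posets and their ab-series\<close>

text \<open>The library's \<open>^\<close> on type \<^typ>\<open>real^'n^'n\<close> is the entrywise power, hence:\<close>

definition mat_power :: "real^'n^'n \<Rightarrow> nat \<Rightarrow> real^'n^'n" where
  "mat_power M k = (((**) M) ^^ k) (mat 1)"

definition Bin :: "real^'n^'n \<Rightarrow> real^'n^'n" where
  "Bin = map_matrix (\<lambda>r. if r \<noteq> 0 then 1 else 0)"

definition binary_matrix :: "real^'n^'n \<Rightarrow> bool" where
  "binary_matrix M \<longleftrightarrow> (\<forall>i j. M $ i $ j \<in> {0, 1})"

definition level_less :: "real^'n^'n \<Rightarrow> 'n \<times> int \<Rightarrow> 'n \<times> int \<Rightarrow> bool" where
  "level_less M = (\<lambda>(u, i) (v, j). i < j \<and> mat_power M (nat (j - i)) $ u $ v > 0)"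

definition level_le :: "real^'n^'n \<Rightarrow> 'n \<times> int \<Rightarrow> 'n \<times> int \<Rightarrow> bool" where
  "level_le M p q \<longleftrightarrow> p = q \<or> level_less M p q"

definition level_interval :: "real^'n^'n \<Rightarrow> 'n \<times> int \<Rightarrow> 'n \<times> int \<Rightarrow> ('n \<times> int) set" where
  "level_interval M p q = {r. level_le M p r \<and> level_le M r q}"

definition ab_index_interval :: "real^'n^'n \<Rightarrow> 'n \<times> int \<Rightarrow> 'n \<times> int \<Rightarrow> ab ncseries" where
  "ab_index_interval M p q =
     (if level_le M p q then ab_index (level_interval M p q) (level_less M) snd p q else 0)"

text \<open>The sum over \<open>m\<close> is formal: the term of index \<open>m\<close> is homogeneous of degree \<open>m\<close>, so each
  coefficient is a sum with at most one nonzero term.\<close>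

definition ab_series :: "real^'n^'n \<Rightarrow> ab ncseries^'n^'n" where
  "ab_series M = (\<chi> x y. Abs_nc (\<lambda>w. \<Sum>m. coeff_nc (ab_index_interval M (x, 0) (y, int m + 1)) w))"

definition K_series :: "real^'n^'n \<Rightarrow> real fps^'n^'n" where
  "K_series M = (\<chi> x y. Abs_fps (\<lambda>k. if k = 0 then M $ x $ y else Bin (mat_power M (k + 1)) $ x $ y))"

lemma mat_power_add: "mat_power M (k + l) = mat_power M k ** mat_power M l"
  by (induction k) (simp_all add: mat_power_def matrix_mul_assoc)

lemma mat_power_nonneg:
  assumes "binary_matrix M"
  shows "0 \<le> mat_power M k $ i $ j"
proof (induction k arbitrary: i j)
  case 0
  then show ?case by (simp add: mat_power_def mat_def)
next
  case (Suc k)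
  have "0 \<le> M $ i $ l" for l
    using assms unfolding binary_matrix_def by (metis insertE order_refl singletonD zero_le_one)
  then show ?case using Suc
    by (auto simp: mat_power_def matrix_matrix_mult_def intro!: sum_nonneg mult_nonneg_nonneg)
qed

lemma level_less_trans:
  assumes "binary_matrix M" "level_less M p q" "level_less M q r"
  shows "level_less M p r"
proof -
  obtain u i v j w k where [simp]: "p = (u, i)" "q = (v, j)" "r = (w, k)"
    by (metis surj_pair)
  have ij: "i < j" "j < k" and pos: "0 < mat_power M (nat (j - i)) $ u $ v"
    "0 < mat_power M (nat (k - j)) $ v $ w"
    using assms(2,3) by (auto simp: level_less_def)
  have "nat (k - i) = nat (j - i) + nat (k - j)" using ij by simp
  moreover have "0 < (mat_power M (nat (j - i)) ** mat_power M (nat (k - j))) $ u $ w"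
    using pos mat_power_nonneg[OF assms(1)]
    by (auto simp: matrix_matrix_mult_def intro!: sum_pos2[of _ v] mult_nonneg_nonneg)
  ultimately show ?thesis using ij by (simp add: level_less_def mat_power_add)
qed

lemma finite_level_interval: "finite (level_interval M p q)"
proof (rule finite_subset)
  show "level_interval M p q \<subseteq> UNIV \<times> {snd p..snd q}"
    by (cases p; cases q) (auto simp: level_interval_def level_le_def level_less_def)
qed simp

lemma finite_bounded_chains_level: "finite (bounded_chains (level_interval M p q) (level_less M) x y)"
proof (rule finite_subset)
  have "distinct c" if "sorted_wrt (level_less M) c" for c
    using that by (induction c) (auto simp: level_less_def)
  then show "bounded_chains (level_interval M p q) (level_less M) x y
      \<subseteq> {c. set c \<subseteq> level_interval M p q \<and> distinct c}"
    by (auto simp: bounded_chains_def)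
  show "finite {c. set c \<subseteq> level_interval M p q \<and> distinct c}"
    by (rule finite_subset_distinct[OF finite_level_interval])
qed

end

theory Submission
  imports Defs
begin

text \<open>Comparing coefficients at \<open>u t v\<close>, the equation \<open>\<Delta>(X) = X t X\<close> says
  \<open>X(u a v) + X(u b v) = X(u) X(v)\<close> for the matrices of coefficients of \<open>X\<close>. Solving for
  \<open>X(u b v)\<close> eliminates the letters \<open>b\<close> one at a time, so \<open>X\<close> is determined by its
  coefficients at the powers of \<open>a\<close>, and any choice of these extends to a solution. For the
  \<open>ab\<close>-series only the case \<open>u = a\<^sup>k\<close> is needed, and there the contributions to the left-hand
  side of all chains cancel, except for those chains whose second element lies \<open>k + 1\<close> levels
  above the minimum and below the maximum; removing the minimum from such a chain gives the
  right-hand side.\<close>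

section \<open>The system of equations in terms of coefficients\<close>

lemma coeff_sum: "coeff_nc (\<Sum>i\<in>A. f i) w = (\<Sum>i\<in>A. coeff_nc (f i) w)"
  by (induction A rule: infinite_finite_induct) (simp_all add: zero_ncseries.rep_eq plus_ncseries.rep_eq)

lemma coeff_one: "coeff_nc 1 w = (if w = [] then 1 else 0)"
  by transfer simp

lemma coeff_var_mult_Nil: "coeff_nc (var x * f) [] = 0"
  by (simp add: coeff_mult word.rep_eq)

lemma coeff_var_mult_Cons: "coeff_nc (var x * f) (y # w) = (if y = x then coeff_nc f w else 0)"
  by (subst coeff_mult_homogeneous[where k = 1]) (auto simp: word.rep_eq)

lemma coeff_incl: "coeff_nc (incl f) (map AB w) = coeff_nc f w"
proof -
  have inj: "map AB w = map AB v \<longleftrightarrow> v = w" for v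
    by (auto simp: inj_map_eq_map inj_def)
  show ?thesis
    by (simp add: incl_def coeff_extend word.rep_eq inj sum.delta finite_words if_distrib cong: if_cong)
qed

lemma coeff_incl_Vt:
  assumes "Vt \<in> set v"
  shows "coeff_nc (incl f) v = 0"
proof -
  have "v \<noteq> map AB w" for w
    using assms by auto
  then show ?thesis
    by (simp add: incl_def coeff_extend word.rep_eq)
qed

section \<open>Coefficients of the derivation\<close>

lemma coeff_Delta_word_map: "coeff_nc (Delta_word w) (map AB u) = 0"
proof (induction w arbitrary: u)
  case Nil
  then show ?case by (simp add: zero_ncseries.rep_eq)
next
  case (Cons x w)
  then show ?case
    by (cases u)
       (auto simp: plus_ncseries.rep_eq coeff_var_mult_Nil coeff_var_mult_Cons
             simp del: word_append)
qed

text \<open>The words of \<open>Delta_word w\<close> arise by turning one letter of \<open>w\<close>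
  into \<open>Vt\<close>; the prefix \<open>map AB u\<close> fixes its position, so at most one of
  them matches.\<close>

lemma coeff_Delta_word:
  "coeff_nc (Delta_word w) (map AB u @ Vt # v)
    = (if \<exists>x u'. w = u @ x # u' \<and> v = map AB u' then 1 else 0)"
proof (induction w arbitrary: u)
  case Nil
  then show ?case by (simp add: zero_ncseries.rep_eq)
next
  case (Cons x w)
  then show ?case
    by (cases u)
       (auto simp: plus_ncseries.rep_eq coeff_var_mult_Cons word.rep_eq)
qed

lemma coeff_Delta_map: "coeff_nc (Delta f) (map AB w) = 0"
  by (simp add: Delta_def coeff_extend coeff_Delta_word_map)

lemma coeff_Delta_Vt:
  assumes "Vt \<in> set v"
  shows "coeff_nc (Delta f) (map AB u @ Vt # v) = 0"
proof -
  have "v \<noteq> map AB w" for w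
    using assms by auto
  then show ?thesis
    by (simp add: Delta_def coeff_extend coeff_Delta_word)
qed

lemma coeff_Delta:
  "coeff_nc (Delta f) (map AB u @ Vt # map AB v)
    = coeff_nc f (u @ Va # v) + coeff_nc f (u @ Vb # v)"
proof -
  have inj: "map AB v = map AB v' \<longleftrightarrow> v' = v" for v'
    by (auto simp: inj_map_eq_map inj_def)
  have "coeff_nc (Delta f) (map AB u @ Vt # map AB v)
      = (\<Sum>w | length w = length (map AB u @ Vt # map AB v).
          if \<exists>x. w = u @ x # v then coeff_nc f w else 0)"
    unfolding Delta_def coeff_extend coeff_Delta_word inj by (intro sum.cong) auto
  also have "\<dots> = (\<Sum>w\<in>{u @ Va # v, u @ Vb # v}. coeff_nc f w)"
  proof (rule sum.mono_neutral_cong_right)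
    show "\<forall>w\<in>{w. length w = length (map AB u @ Vt # map AB v)} - {u @ Va # v, u @ Vb # v}.
        (if \<exists>x. w = u @ x # v then coeff_nc f w else 0) = 0"
      by (auto, metis ab.exhaust)
  qed (auto simp: finite_words)
  finally show ?thesis by simp
qed

section \<open>Products with \<open>var Vt\<close> between two series in a and b\<close>

lemma coeff_incl_Vt_incl_map: "coeff_nc (incl f * var Vt * incl g) (map AB w) = 0"
proof -
  have "coeff_nc (var Vt * incl g) (map AB v) = 0" for v
    by (cases v) (simp_all add: coeff_var_mult_Nil coeff_var_mult_Cons)
  then show ?thesis
    by (simp add: mult.assoc coeff_mult[of "incl f"] drop_map)
qed

lemma coeff_incl_Vt_incl:
  "coeff_nc (incl f * var Vt * incl g) (map AB u @ Vt # v) = coeff_nc f u * coeff_nc (incl g) v"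
proof -
  let ?w = "map AB u @ Vt # v"
  \<comment> \<open>Only the cut just before the displayed \<open>Vt\<close> counts: an earlier one
    starts the second factor with a letter other than \<open>Vt\<close>, a later one leaves
    \<open>Vt\<close> to \<open>incl f\<close>, a series in a and b alone.\<close>
  have "coeff_nc (incl f) (take i ?w) * coeff_nc (var Vt * incl g) (drop i ?w) = 0"
    if "i \<noteq> length u" for i
  proof (cases "i < length u")
    case True
    then have "drop i ?w = AB (u ! i) # drop (Suc i) (map AB u) @ Vt # v"
      by (simp add: Cons_nth_drop_Suc[symmetric])
    then show ?thesis by (simp add: coeff_var_mult_Cons)
  next
    case False
    with that have "Vt \<in> set (take i ?w)"
      by (cases "i - length u") auto
    then show ?thesis by (simp add: coeff_incl_Vt)
  qed
  then have "coeff_nc (incl f * (var Vt * incl g)) ?w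
      = (\<Sum>i\<in>{length u}. coeff_nc (incl f) (take i ?w) * coeff_nc (var Vt * incl g) (drop i ?w))"
    unfolding coeff_mult[of "incl f"] by (intro sum.mono_neutral_right) auto
  then show ?thesis
    by (simp add: mult.assoc coeff_incl coeff_var_mult_Cons)
qed

lemma abt_list_cases:
  obtains (none) w where "v = map AB w"
  | (one) u w where "v = map AB u @ Vt # map AB w"
  | (more) u w where "v = map AB u @ Vt # w" "Vt \<in> set w"
proof -
  have AB: "\<exists>w. v = map AB w" if "Vt \<notin> set v" for v
    using that unfolding ex_map_conv by (metis abt.exhaust)
  show thesis
  proof (cases "Vt \<in> set v")
    case True
    then obtain us ws where v: "v = us @ Vt # ws" "Vt \<notin> set us"
      by (metis split_list_first)
    then show thesis using AB one more by metis
  qed (use AB none in blast)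
qed

text \<open>Both sides vanish at words with no \<open>Vt\<close> or with several, so only words with
  exactly one have to be compared.\<close>

lemma Delta_equation_iff:
  fixes X :: "ab ncseries^'n^'n"
  shows "map_matrix Delta X = map_matrix incl X ** mat (var Vt) ** map_matrix incl X \<longleftrightarrow>
    (\<forall>x y u v. coeff_nc (X $ x $ y) (u @ Va # v) + coeff_nc (X $ x $ y) (u @ Vb # v)
      = (\<Sum>z\<in>UNIV. coeff_nc (X $ x $ z) u * coeff_nc (X $ z $ y) v))"
    (is "?L \<longleftrightarrow> ?R")
proof -
  have entry: "(map_matrix incl X ** mat (var Vt) ** map_matrix incl X) $ x $ y
      = (\<Sum>z\<in>UNIV. incl (X $ x $ z) * var Vt * incl (X $ z $ y))" for x y
    by (simp add: matrix_matrix_mult_def mat_def map_matrix_def if_distrib sum.delta cong: if_cong)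
  have "?L \<longleftrightarrow> (\<forall>x y v. coeff_nc (Delta (X $ x $ y)) v
      = (\<Sum>z\<in>UNIV. coeff_nc (incl (X $ x $ z) * var Vt * incl (X $ z $ y)) v))"
    unfolding vec_eq_iff entry coeff_sum[symmetric] by (auto simp: map_matrix_def intro: nc_eqI)
  also have "\<dots> \<longleftrightarrow> ?R"
  proof (intro iffI allI)
    fix x y u v
    assume "\<forall>x y v. coeff_nc (Delta (X $ x $ y)) v
      = (\<Sum>z\<in>UNIV. coeff_nc (incl (X $ x $ z) * var Vt * incl (X $ z $ y)) v)"
    then have "coeff_nc (Delta (X $ x $ y)) (map AB u @ Vt # map AB v)
      = (\<Sum>z\<in>UNIV. coeff_nc (incl (X $ x $ z) * var Vt * incl (X $ z $ y)) (map AB u @ Vt # map AB v))"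
      by blast
    then show "coeff_nc (X $ x $ y) (u @ Va # v) + coeff_nc (X $ x $ y) (u @ Vb # v)
      = (\<Sum>z\<in>UNIV. coeff_nc (X $ x $ z) u * coeff_nc (X $ z $ y) v)"
      by (simp add: coeff_Delta coeff_incl_Vt_incl coeff_incl)
  next
    fix x y v
    assume R: ?R
    show "coeff_nc (Delta (X $ x $ y)) v
      = (\<Sum>z\<in>UNIV. coeff_nc (incl (X $ x $ z) * var Vt * incl (X $ z $ y)) v)"
      by (cases v rule: abt_list_cases)
         (simp_all add: R coeff_Delta_map coeff_Delta_Vt coeff_Delta coeff_incl_Vt coeff_incl
            coeff_incl_Vt_incl coeff_incl_Vt_incl_map)
  qed
  finally show ?thesis .
qed

section \<open>The substitution a = t, b = 0 on coefficients\<close>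

lemma prod_list_subst_letter:
  "prod_list (map subst_letter w) = (if w = replicate (length w) Va then fps_X ^ length w else 0)"
proof (induction w)
  case (Cons x w)
  then show ?case by (cases x) auto
qed simp

lemma subst_a_t_b_0_nth: "fps_nth (subst_a_t_b_0 f) k = coeff_nc f (replicate k Va)"
proof -
  have "fps_nth (subst_a_t_b_0 f) k
      = (\<Sum>w | length w = k. if w = replicate k Va then coeff_nc f w else 0)"
    unfolding subst_a_t_b_0_def by (auto simp: prod_list_subst_letter intro!: sum.cong)
  then show ?thesis by (simp add: finite_words)
qed

lemma subst_equation_iff:
  assumes "binary_matrix M"
  shows "map_matrix subst_a_t_b_0 X = K_series M \<longleftrightarrow>
    (\<forall>x y k. coeff_nc (X $ x $ y) (replicate k Va) = Bin (mat_power M (Suc k)) $ x $ y)"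
proof -
  \<comment> \<open>Since \<open>M\<close> is binary, the constant term of \<open>K_series\<close>
    fits the pattern of the later ones.\<close>
  have "M $ x $ y = Bin (mat_power M 1) $ x $ y" for x y
    using assms by (auto simp: binary_matrix_def mat_power_def Bin_def map_matrix_def)
  then have "fps_nth (K_series M $ x $ y) k = Bin (mat_power M (Suc k)) $ x $ y" for x y k
    by (simp add: K_series_def)
  then show ?thesis
    by (simp add: vec_eq_iff map_matrix_def fps_eq_iff subst_a_t_b_0_nth)
qed

section \<open>Solving the system\<close>

text \<open>The coefficient of the solution at \<open>a\<^sup>k w\<close>, given its coefficients \<open>K k\<close> at \<open>a\<^sup>k\<close>.\<close>

primrec solution_coeff :: "(nat \<Rightarrow> real^'n^'n) \<Rightarrow> ab list \<Rightarrow> nat \<Rightarrow> real^'n^'n" where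
  "solution_coeff K [] k = K k"
| "solution_coeff K (x # w) k = (case x of
     Va \<Rightarrow> solution_coeff K w (Suc k)
   | Vb \<Rightarrow> K k ** solution_coeff K w 0 - solution_coeff K w (Suc k))"

lemma matrix_diff_rdistrib: "(A - B) ** C = A ** C - B ** C" for A B :: "real^'n^'n" and C :: "real^'n^'n"
  by (simp add: matrix_matrix_mult_def vec_eq_iff left_diff_distrib sum_subtractf)

text \<open>Any initial values \<open>K\<close> yield a solution: the base case is the defining
  clause at \<open>Vb\<close>, and if \<open>u\<close> starts with \<open>Vb\<close>, that clause
  and the induction hypothesis at \<open>0\<close> and \<open>Suc k\<close> let
  \<open>solution_coeff K v 0\<close> factor out on the right.\<close>

lemma solution_coeff_Va_Vb:
  "solution_coeff K (u @ Va # v) k + solution_coeff K (u @ Vb # v) k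
    = solution_coeff K u k ** solution_coeff K v 0"
proof (induction u arbitrary: k)
  case (Cons x u)
  show ?case
  proof (cases x)
    case Vb
    have "solution_coeff K (x # u @ Va # v) k + solution_coeff K (x # u @ Vb # v) k
        = K k ** (solution_coeff K (u @ Va # v) 0 + solution_coeff K (u @ Vb # v) 0)
          - (solution_coeff K (u @ Va # v) (Suc k) + solution_coeff K (u @ Vb # v) (Suc k))"
      using Vb by (simp add: matrix_add_ldistrib)
    then show ?thesis
      using Vb by (simp add: Cons.IH matrix_diff_rdistrib matrix_mul_assoc)
  qed (simp add: Cons.IH)
qed simp

lemma solution_coeff_replicate: "solution_coeff K (replicate k Va) l = K (k + l)"
  by (induction k arbitrary: l) simp_all

text \<open>The index \<open>i\<close> is there for intervals of a level poset, where it is the level of the minimum: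
  removing the minimum of a chain moves the family to another level.\<close>

lemma eq_solution_coeff:
  fixes F :: "'i \<Rightarrow> ab list \<Rightarrow> real^'n^'n"
  assumes init: "\<And>i k. F i (replicate k Va) = K k"
    and step: "\<And>i k w. \<exists>j. F i (replicate k Va @ Va # w) + F i (replicate k Va @ Vb # w) = K k ** F j w"
  shows "F i (replicate k Va @ w) = solution_coeff K w k"
proof (induction w arbitrary: i k)
  case Nil
  then show ?case by (simp add: init)
next
  case (Cons x w)
  \<comment> \<open>The letter a is absorbed into the prefix, for which the induction hypothesis
    allows any length.\<close>
  have Va: "F i (replicate k Va @ Va # w) = solution_coeff K w (Suc k)"
    using Cons.IH[of i "Suc k"] by (simp add: replicate_app_Cons_same)
  obtain j where "F i (replicate k Va @ Va # w) + F i (replicate k Va @ Vb # w) = K k ** F j w"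
    using step by blast
  moreover have "F j w = solution_coeff K w 0"
    using Cons.IH[of j 0] by simp
  ultimately show ?case
    using Va by (cases x) (simp_all add: algebra_simps eq_diff_eq)
qed

lemma system_iff_solution_coeff:
  fixes X :: "ab ncseries^'n^'n"
  shows "(\<forall>x y k. coeff_nc (X $ x $ y) (replicate k Va) = K k $ x $ y) \<and>
      (\<forall>x y u v. coeff_nc (X $ x $ y) (u @ Va # v) + coeff_nc (X $ x $ y) (u @ Vb # v)
        = (\<Sum>z\<in>UNIV. coeff_nc (X $ x $ z) u * coeff_nc (X $ z $ y) v))
    \<longleftrightarrow> (\<forall>x y w. coeff_nc (X $ x $ y) w = solution_coeff K w 0 $ x $ y)"
    (is "?init \<and> ?quadratic \<longleftrightarrow> ?solution")
proof (intro iffI conjI)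
  assume solution: ?solution
  then show ?init
    by (simp add: solution_coeff_replicate)
  show ?quadratic
    using solution_coeff_Va_Vb[of K _ _ 0]
    by (simp add: solution vec_eq_iff matrix_matrix_mult_def)
next
  assume system: "?init \<and> ?quadratic"
  \<comment> \<open>The coefficients of \<open>X\<close> carry no level, so a one-element index type
    suffices.\<close>
  define F where "F = (\<lambda>(_::unit) w. (\<chi> x y. coeff_nc (X $ x $ y) w) :: real^'n^'n)"
  have "F i (replicate k Va) = K k" for i k
    using system by (simp add: F_def vec_eq_iff)
  \<comment> \<open>The quadratic equation is used only at u = a^k, where its left factor is
    \<open>K k\<close>.\<close>
  moreover have "\<exists>j. F i (replicate k Va @ Va # w) + F i (replicate k Va @ Vb # w) = K k ** F j w" for i k w
    using system by (simp add: F_def vec_eq_iff matrix_matrix_mult_def)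
  ultimately have "F () w = solution_coeff K w 0" for w
    using eq_solution_coeff[of F K "()" 0 w] by simp
  then show ?solution
    by (simp add: F_def vec_eq_iff)
qed

section \<open>Coefficients of the weights of chains\<close>

lemma coeff_a_minus_b_Nil: "coeff_nc ((var Va - var Vb) * f) [] = 0"
  by (simp add: left_diff_distrib minus_ncseries.rep_eq coeff_var_mult_Nil)

lemma coeff_a_minus_b_Cons:
  "coeff_nc ((var Va - var Vb) * f) (x # w) = (case x of Va \<Rightarrow> coeff_nc f w | Vb \<Rightarrow> - coeff_nc f w)"
  by (cases x) (simp_all add: left_diff_distrib minus_ncseries.rep_eq coeff_var_mult_Cons)

lemma coeff_a_minus_b_power_replicate:
  "coeff_nc ((var Va - var Vb) ^ (k + d) * f) (replicate k Va @ w)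
    = coeff_nc ((var Va - var Vb) ^ d * f) w"
  by (induction k) (simp_all add: mult.assoc coeff_a_minus_b_Cons)

lemma coeff_a_minus_b_power_le:
  assumes "d \<le> k"
  shows "coeff_nc ((var Va - var Vb) ^ d * f) (replicate k Va @ w)
    = coeff_nc f (replicate (k - d) Va @ w)"
  using coeff_a_minus_b_power_replicate[of d 0 f "replicate (k - d) Va @ w"] assms
  by (simp flip: append_assoc replicate_add)

lemma coeff_a_minus_b_power_gt:
  assumes "k < d"
  shows "coeff_nc ((var Va - var Vb) ^ d * f) (replicate k Va @ w)
    = coeff_nc ((var Va - var Vb) * ((var Va - var Vb) ^ (d - Suc k) * f)) w"
  using coeff_a_minus_b_power_replicate[of k "Suc (d - Suc k)" f w] assms
  by (simp add: mult.assoc)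

text \<open>In a weight, what follows the first power of a - b is \<open>1\<close> or starts with b,
  hence the hypothesis. If \<open>d < k\<close>, a letter a is left for \<open>f\<close>; if
  \<open>d > k\<close>, a factor a - b without constant term is left.\<close>

lemma coeff_a_minus_b_power_Va:
  assumes "\<And>w. coeff_nc f (Va # w) = 0"
  shows "coeff_nc ((var Va - var Vb) ^ d * f) (replicate k Va) = (if d = k then coeff_nc f [] else 0)"
  using coeff_a_minus_b_power_le[of d k f "[]"] coeff_a_minus_b_power_gt[of k d f "[]"] assms
  by (cases "k - d"; cases "d \<le> k") (auto simp: coeff_a_minus_b_Nil)

text \<open>The cancellation: if \<open>d > k\<close>, the next factor a - b gives the two words
  opposite signs; if \<open>d < k\<close>, both terms vanish because \<open>f\<close> would have to
  start with a.\<close>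

lemma coeff_a_minus_b_power_Va_Vb:
  assumes "\<And>w. coeff_nc f (Va # w) = 0"
  shows "coeff_nc ((var Va - var Vb) ^ d * f) (replicate k Va @ Va # w)
       + coeff_nc ((var Va - var Vb) ^ d * f) (replicate k Va @ Vb # w)
       = (if d = k then coeff_nc f (Vb # w) else 0)"
proof (cases "d \<le> k")
  case True
  then show ?thesis
    using assms by (cases "k - d") (auto simp: coeff_a_minus_b_power_le)
next
  case False
  then show ?thesis
    by (simp add: coeff_a_minus_b_power_gt coeff_a_minus_b_Cons)
qed

lemma coeff_a_minus_b_power_homogeneous:
  assumes "\<And>w. length w \<noteq> n \<Longrightarrow> coeff_nc f w = 0" and "length w \<noteq> d + n"
  shows "coeff_nc ((var Va - var Vb) ^ d * f) w = 0"
  using assms(2)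
proof (induction d arbitrary: w)
  case 0
  then show ?case using assms(1) by simp
next
  case (Suc d)
  then show ?case
    by (cases w) (auto simp: mult.assoc coeff_a_minus_b_Nil coeff_a_minus_b_Cons split: ab.split)
qed

text \<open>What follows the first power of a - b is \<open>1\<close> for a two-element chain, with
  no term in b; otherwise it is b times the weight of the chain without its minimum.\<close>

lemma coeff_wt_Va_Vb:
  "coeff_nc (wt rk (p # r # c)) (replicate k Va @ Va # w)
     + coeff_nc (wt rk (p # r # c)) (replicate k Va @ Vb # w)
   = (if c \<noteq> [] \<and> nat (rk r - rk p - 1) = k then coeff_nc (wt rk (r # c)) w else 0)"
proof (cases c)
  case Nil
  then show ?thesis
    using coeff_a_minus_b_power_Va_Vb[of 1 "nat (rk r - rk p - 1)" k w]
    by (simp add: coeff_one)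
next
  case (Cons s c')
  then show ?thesis
    using coeff_a_minus_b_power_Va_Vb[of "var Vb * wt rk (r # c)" "nat (rk r - rk p - 1)" k w]
    by (simp add: mult.assoc coeff_var_mult_Cons)
qed

lemma coeff_wt_replicate:
  "coeff_nc (wt rk (p # r # c)) (replicate k Va)
    = (if c = [] \<and> nat (rk r - rk p - 1) = k then 1 else 0)"
proof (cases c)
  case Nil
  then show ?thesis
    using coeff_a_minus_b_power_Va[of 1 "nat (rk r - rk p - 1)" k]
    by (simp add: coeff_one)
next
  case (Cons s c')
  then show ?thesis
    using coeff_a_minus_b_power_Va[of "var Vb * wt rk (r # c)" "nat (rk r - rk p - 1)" k]
    by (simp add: mult.assoc coeff_var_mult_Nil coeff_var_mult_Cons)
qed

text \<open>Each gap contributes its length minus one and each b between two gaps restores one, so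
  the degree is the total rank difference minus one.\<close>

lemma coeff_wt_homogeneous:
  assumes "sorted_wrt (\<lambda>p q. rk p < rk q) c" "2 \<le> length c" "int (length w) \<noteq> rk (last c) - rk (hd c) - 1"
  shows "coeff_nc (wt rk c) w = 0"
  using assms
proof (induction rk c arbitrary: w rule: wt.induct)
  case (1 rk p r s c)
  have "coeff_nc (var Vb * wt rk (r # s # c)) v = 0"
    if "int (length v) \<noteq> rk (last (s # c)) - rk r" for v
    using that 1 by (cases v) (simp_all add: coeff_var_mult_Nil coeff_var_mult_Cons)
  moreover have "rk p < rk r" "rk r < rk (last (s # c))"
    using 1(2) last_in_set[of "s # c"] by auto
  ultimately have "coeff_nc ((var Va - var Vb) ^ nat (rk r - rk p - 1) * (var Vb * wt rk (r # s # c))) w = 0"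
    using 1(4)
    by (intro coeff_a_minus_b_power_homogeneous[where n = "nat (rk (last (s # c)) - rk r)"]) auto
  then show ?case by (simp add: mult.assoc)
next
  case (2 rk p r)
  then show ?case
    using coeff_a_minus_b_power_homogeneous[of 0 1 w "nat (rk r - rk p - 1)"]
    by (simp add: coeff_one)
qed simp_all

section \<open>Chains in level posets\<close>

text \<open>Frees chains from their carrier, so that removing or adding a minimum needs no change of
  interval.\<close>

lemma bounded_chains_level_interval:
  "bounded_chains (level_interval M p q) (level_less M) p q = bounded_chains UNIV (level_less M) p q"
proof -
  have "set c \<subseteq> level_interval M p q"
    if c: "sorted_wrt (level_less M) c" "2 \<le> length c" "hd c = p" "last c = q" for c
  proof
    fix r assume "r \<in> set c"
    then obtain us vs where "c = us @ r # vs"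
      by (metis split_list)
    then show "r \<in> level_interval M p q"
      using c by (cases us; cases vs rule: rev_cases)
        (auto simp: level_interval_def level_le_def sorted_wrt_append)
  qed
  then show ?thesis by (auto simp: bounded_chains_def)
qed

lemma ab_index_interval_eq:
  "ab_index_interval M p q = (\<Sum>c\<in>bounded_chains UNIV (level_less M) p q. wt snd c)"
proof (cases "level_le M p q")
  case True
  then show ?thesis
    by (simp add: ab_index_interval_def ab_index_def bounded_chains_level_interval)
next
  case False
  have "level_less M p q" if "c \<in> bounded_chains UNIV (level_less M) p q" for c
    using that by (cases c) (auto simp: bounded_chains_def split: if_splits)
  \<comment> \<open>The empty sum matches the default value 0 for incomparable endpoints.\<close>
  with False have "bounded_chains UNIV (level_less M) p q = {}"
    by (auto simp: level_le_def)
  with False show ?thesis by (simp add: ab_index_interval_def)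
qed

lemma finite_bounded_chains: "finite (bounded_chains UNIV (level_less M) p q)"
  using finite_bounded_chains_level[of M p q p q] by (simp add: bounded_chains_level_interval)

lemma bounded_chainsE:
  assumes "c \<in> bounded_chains UNIV lt p q"
  obtains r c' where "c = p # r # c'"
  using assms by (cases c rule: remdups_adj.cases) (auto simp: bounded_chains_def)

section \<open>The recursion for ab-indices of level intervals\<close>

lemma Bin_mat_power_entry:
  assumes "binary_matrix M"
  shows "Bin (mat_power M (Suc k)) $ x $ z = (if level_less M (x, i) (z, i + int k + 1) then 1 else 0)"
proof -
  have "nat (int k + 1) = Suc k" by simp
  then show ?thesis
    using mat_power_nonneg[OF assms, of "Suc k" x z]
    by (auto simp: Bin_def map_matrix_def level_less_def add.assoc)
qed

text \<open>Only the two-element chain contributes; its weight (a - b)^k has coefficient 1 at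
  a^k.\<close>

lemma coeff_ab_index_interval_replicate:
  assumes "binary_matrix M"
  shows "coeff_nc (ab_index_interval M (x, i) (y, i + int k + 1)) (replicate k Va)
    = Bin (mat_power M (Suc k)) $ x $ y"
proof -
  let ?p = "(x, i)" and ?q = "(y, i + int k + 1)"
  let ?C = "bounded_chains UNIV (level_less M) ?p ?q"
  have "coeff_nc (wt snd c) (replicate k Va) = (if c = [?p, ?q] then 1 else 0)" if "c \<in> ?C" for c
  proof -
    from that obtain r c' where "c = ?p # r # c'"
      by (rule bounded_chainsE)
    then show ?thesis
      using that by (auto simp: coeff_wt_replicate bounded_chains_def)
  qed
  then have "coeff_nc (ab_index_interval M ?p ?q) (replicate k Va) = (if [?p, ?q] \<in> ?C then 1 else 0)"
    by (simp add: ab_index_interval_eq coeff_sum finite_bounded_chains sum.delta)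
  also have "[?p, ?q] \<in> ?C \<longleftrightarrow> level_less M ?p ?q"
    by (simp add: bounded_chains_def)
  finally show ?thesis
    by (simp add: Bin_mat_power_entry[OF assms, of k x y i])
qed

lemma coeff_ab_index_interval_Va_Vb:
  assumes "binary_matrix M"
  shows "coeff_nc (ab_index_interval M (x, i) q) (replicate k Va @ Va # w)
      + coeff_nc (ab_index_interval M (x, i) q) (replicate k Va @ Vb # w)
    = (\<Sum>z\<in>UNIV. Bin (mat_power M (Suc k)) $ x $ z
        * coeff_nc (ab_index_interval M (z, i + int k + 1) q) w)"
proof -
  let ?p = "(x, i)" and ?r = "\<lambda>z. (z, i + int k + 1)"
  let ?C = "\<lambda>p. bounded_chains UNIV (level_less M) p q"
  let ?D = "{c \<in> ?C ?p. tl (tl c) \<noteq> [] \<and> snd (c ! 1) = i + int k + 1}"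
  have "coeff_nc (wt snd c) (replicate k Va @ Va # w) + coeff_nc (wt snd c) (replicate k Va @ Vb # w)
      = (if tl (tl c) \<noteq> [] \<and> snd (c ! 1) = i + int k + 1 then coeff_nc (wt snd (tl c)) w else 0)"
    if "c \<in> ?C ?p" for c
  proof -
    from that obtain r c' where c: "c = ?p # r # c'"
      by (rule bounded_chainsE)
    then have "i < snd r"
      using that by (auto simp: bounded_chains_def level_less_def)
    \<comment> \<open>The gap is at least 1, so \<open>nat\<close> truncates nothing.\<close>
    then have "nat (snd r - i - 1) = k \<longleftrightarrow> snd r = i + int k + 1"
      by auto
    then show ?thesis
      using c by (simp add: coeff_wt_Va_Vb)
  qed
  then have "coeff_nc (ab_index_interval M ?p q) (replicate k Va @ Va # w)
      + coeff_nc (ab_index_interval M ?p q) (replicate k Va @ Vb # w)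
    = (\<Sum>c\<in>?D. coeff_nc (wt snd (tl c)) w)"
    by (simp add: ab_index_interval_eq coeff_sum finite_bounded_chains sum.inter_filter
        flip: sum.distrib)
  \<comment> \<open>The surviving chains are sorted by the vertex \<open>z\<close> of their second
    element, whose level is fixed, and lose their minimum.\<close>
  also have "\<dots> = (\<Sum>(z, c)\<in>(SIGMA z:{z. level_less M ?p (?r z)}. ?C (?r z)). coeff_nc (wt snd c) w)"
  proof (rule sum.reindex_bij_witness[where i = "\<lambda>(z, c). ?p # c" and j = "\<lambda>c. (fst (c ! 1), tl c)"])
    fix c assume c: "c \<in> ?D"
    then obtain r c' where "c = ?p # r # c'"
      using bounded_chainsE[of c "level_less M" ?p q] by blast
    with c show "(case (fst (c ! 1), tl c) of (z, c) \<Rightarrow> ?p # c) = c"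
      and "(fst (c ! 1), tl c) \<in> (SIGMA z:{z. level_less M ?p (?r z)}. ?C (?r z))"
      and "(case (fst (c ! 1), tl c) of (z, c) \<Rightarrow> coeff_nc (wt snd c) w) = coeff_nc (wt snd (tl c)) w"
      by (cases r; cases c'; auto simp: bounded_chains_def)+
  next
    fix zc assume "zc \<in> (SIGMA z:{z. level_less M ?p (?r z)}. ?C (?r z))"
    then obtain z c where zc: "zc = (z, c)" "level_less M ?p (?r z)" "c \<in> ?C (?r z)"
      by auto
    then obtain s c' where c: "c = ?r z # s # c'"
      using bounded_chainsE[of c "level_less M" "?r z" q] by blast
    \<comment> \<open>\<open>sorted_wrt\<close> compares the new minimum with every later element;
      transitivity supplies all comparisons beyond the first.\<close>
    have "level_less M ?p u" if "u \<in> set (s # c')" for u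
      using zc(3) c that by (intro level_less_trans[OF assms zc(2)]) (auto simp: bounded_chains_def)
    then show "(case zc of (z, c) \<Rightarrow> ?p # c) \<in> ?D"
      and "(fst ((case zc of (z, c) \<Rightarrow> ?p # c) ! 1), tl (case zc of (z, c) \<Rightarrow> ?p # c)) = zc"
      using zc c by (auto simp: bounded_chains_def)
  qed
  also have "\<dots> = (\<Sum>z | level_less M ?p (?r z). coeff_nc (ab_index_interval M (?r z) q) w)"
    by (simp add: ab_index_interval_eq coeff_sum finite_bounded_chains sum.Sigma)
  also have "\<dots> = (\<Sum>z\<in>UNIV. if level_less M ?p (?r z) then coeff_nc (ab_index_interval M (?r z) q) w else 0)"
    by (simp add: sum.inter_filter[of UNIV, simplified])
  also have "\<dots> = (\<Sum>z\<in>UNIV. Bin (mat_power M (Suc k)) $ x $ z * coeff_nc (ab_index_interval M (?r z) q) w)"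
    by (intro sum.cong refl) (simp add: Bin_mat_power_entry[OF assms, of k x _ i])
  finally show ?thesis .
qed

lemma coeff_ab_index_interval_homogeneous:
  assumes "int (length w) \<noteq> snd q - snd p - 1"
  shows "coeff_nc (ab_index_interval M p q) w = 0"
proof -
  have "coeff_nc (wt snd c) w = 0" if "c \<in> bounded_chains UNIV (level_less M) p q" for c
  proof (rule coeff_wt_homogeneous)
    show "sorted_wrt (\<lambda>p q. snd p < snd q) c"
      by (rule sorted_wrt_mono_rel[of c "level_less M"])
         (use that in \<open>auto simp: bounded_chains_def level_less_def\<close>)
  qed (use that assms in \<open>auto simp: bounded_chains_def\<close>)
  then show ?thesis
    by (simp add: ab_index_interval_eq coeff_sum)
qed

lemma coeff_ab_series:
  "coeff_nc (ab_series M $ x $ y) w = coeff_nc (ab_index_interval M (x, 0) (y, int (length w) + 1)) w"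
proof -
  have "(\<Sum>m. coeff_nc (ab_index_interval M (x, 0) (y, int m + 1)) w)
      = (\<Sum>m\<in>{length w}. coeff_nc (ab_index_interval M (x, 0) (y, int m + 1)) w)"
    by (rule suminf_finite) (auto intro!: coeff_ab_index_interval_homogeneous)
  then show ?thesis
    by (simp add: ab_series_def Abs_nc_inverse)
qed

lemma coeff_ab_series_eq_solution_coeff:
  assumes "binary_matrix M"
  shows "coeff_nc (ab_series M $ x $ y) w = solution_coeff (\<lambda>k. Bin (mat_power M (Suc k))) w 0 $ x $ y"
proof -
  \<comment> \<open>By homogeneity, a word \<open>w\<close> can only occur for intervals of rank
    \<open>length w + 1\<close>. The start level varies because removing a minimum raises
    it.\<close>
  define F :: "int \<Rightarrow> ab list \<Rightarrow> real^'a^'a" where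
    "F i w = (\<chi> x y. coeff_nc (ab_index_interval M (x, i) (y, i + int (length w) + 1)) w)" for i w
  have "F i (replicate k Va) = Bin (mat_power M (Suc k))" for i k
    using coeff_ab_index_interval_replicate[OF assms] by (simp add: F_def vec_eq_iff)
  \<comment> \<open>The words on the left have length \<open>k + 1 + length w\<close>, so the
    intervals from levels \<open>i\<close> and \<open>i + int k + 1\<close> end at the same
    level.\<close>
  moreover have "F i (replicate k Va @ Va # w) + F i (replicate k Va @ Vb # w)
      = Bin (mat_power M (Suc k)) ** F (i + int k + 1) w" for i k w
    using coeff_ab_index_interval_Va_Vb[OF assms, of _ i _ k w]
    by (simp add: F_def vec_eq_iff matrix_matrix_mult_def algebra_simps)
  ultimately have "F 0 w = solution_coeff (\<lambda>k. Bin (mat_power M (Suc k))) w 0"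
    using eq_solution_coeff[of F "\<lambda>k. Bin (mat_power M (Suc k))" 0 0 w] by auto
  then show ?thesis
    by (simp add: F_def coeff_ab_series vec_eq_iff)
qed

theorem theorem8p1:
  fixes M :: "real^'n^'n"
  assumes "binary_matrix M"
  shows "\<forall>X :: ab ncseries^'n^'n.
      (map_matrix subst_a_t_b_0 X = K_series M \<and>
       map_matrix Delta X = map_matrix incl X ** mat (var Vt) ** map_matrix incl X)
      \<longleftrightarrow> X = ab_series M"
proof
  fix X :: "ab ncseries^'n^'n"
  have "X = ab_series M \<longleftrightarrow>
      (\<forall>x y w. coeff_nc (X $ x $ y) w = coeff_nc (ab_series M $ x $ y) w)"
    by (auto simp: vec_eq_iff intro: nc_eqI)
  then show "(map_matrix subst_a_t_b_0 X = K_series M \<and>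
       map_matrix Delta X = map_matrix incl X ** mat (var Vt) ** map_matrix incl X)
      \<longleftrightarrow> X = ab_series M"
    \<comment> \<open>Both sides become the statement that the coefficients of \<open>X\<close> are
      those of \<open>solution_coeff\<close> with initial values
      \<open>Bin (mat_power M (Suc k))\<close>.\<close>
    by (simp only: subst_equation_iff[OF assms] Delta_equation_iff system_iff_solution_coeff
        coeff_ab_series_eq_solution_coeff[OF assms])
qed

end
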